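(* Let $X$ be a set with $|X|=3$ and let $\tau$ be the discrete topology on $X$. Then the discrete topological graph $G_\tau$ of $X$ is isomorphic to the corona $K_3\odot K_1$.
   Context: For a non-empty set $X$ with the discrete topology $\tau$ (so $\tau$ is the family of all subsets of $X$), the discrete topological graph $G_\tau=(V,E)$ is the simple undirected graph with vertex set $V=\{A\in\tau : A\neq\emptyset,\ A\neq X\}$ in which two vertices $A,B$ are adjacent if and only if $A\cap B=\emptyset$. The corona $G\odot H$ of two graphs is obtained from one copy of $G$ and $|V(G)|$ disjoint copies of $H$ (one for each vertex of $G$) by joining the $i$-th vertex of $G$ to every vertex of the $i$-th copy of $H$. $K_m$ denotes the complete graph on $m$ vertices. *)

theory Defs
  imports "HOL-Analysis.Abstract_Topology" "Graph_Theory.Pair_Digraph"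
    "Graph_Theory.Digraph_Isomorphism" "Graph_Theory.Kuratowski"
begin

text \<open>
  Following Graph_Theory, a simple undirected graph is a symmetric, loop-free digraph whose arcs
  are pairs of vertices: the edge \<open>{u, v}\<close> is represented by the two arcs \<open>(u, v)\<close> and \<open>(v, u)\<close>.
  For such graphs, isomorphism in the usual sense is \<^const>\<open>digraph_iso\<close>.
\<close>

definition discrete_topological_graph :: "'a topology \<Rightarrow> 'a set pair_pre_digraph" where
  "discrete_topological_graph T =
     (let V = {A. openin T A \<and> A \<noteq> {} \<and> A \<noteq> topspace T}
      in \<lparr> pverts = V, parcs = {(A, B). A \<in> V \<and> B \<in> V \<and> A \<inter> B = {}} \<rparr>)"

text \<open>
  The simple graph in which distinct vertices are always adjacent, realised on \<open>{..<m}\<close>.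
\<close>

definition complete_pair_graph :: "nat \<Rightarrow> nat pair_pre_digraph" where
  "complete_pair_graph m =
     \<lparr> pverts = {..<m}, parcs = {(u, v). u < m \<and> v < m \<and> u \<noteq> v} \<rparr>"

text \<open>
  \<open>Inl g\<close> is the vertex \<open>g\<close> of the copy of \<open>G\<close>; \<open>Inr (g, h)\<close> is the vertex \<open>h\<close> in the copy of \<open>H\<close>
  belonging to \<open>g\<close>.
\<close>

definition corona ::
  "'a pair_pre_digraph \<Rightarrow> 'b pair_pre_digraph \<Rightarrow> ('a + 'a \<times> 'b) pair_pre_digraph" where
  "corona G H =
     \<lparr> pverts = Inl ` pverts G \<union> Inr ` (pverts G \<times> pverts H),
       parcs = {(Inl u, Inl v) | u v. (u, v) \<in> parcs G}
             \<union> {(Inr (g, x), Inr (g, y)) | g x y. g \<in> pverts G \<and> (x, y) \<in> parcs H}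
             \<union> {(Inl g, Inr (g, x)) | g x. g \<in> pverts G \<and> x \<in> pverts H}
             \<union> {(Inr (g, x), Inl g) | g x. g \<in> pverts G \<and> x \<in> pverts H} \<rparr>"

lemma pair_bidirected_digraph_discrete_topological_graph:
  "pair_bidirected_digraph (discrete_topological_graph T)"
  by unfold_locales
     (auto simp: discrete_topological_graph_def Let_def symmetric_def intro!: symI)

lemma complete_digraph_complete_pair_graph:
  "complete_digraph m (with_proj (complete_pair_graph m))"
  by (auto simp: complete_digraph_pair_def complete_pair_graph_def)

lemma pair_bidirected_digraph_corona:
  assumes "pair_bidirected_digraph G" "pair_bidirected_digraph H"
  shows "pair_bidirected_digraph (corona G H)"
proof -
  interpret G: pair_bidirected_digraph G by fact
  interpret H: pair_bidirected_digraph H by fact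
  have G: "(u, v) \<in> parcs G \<Longrightarrow> u \<in> pverts G \<and> v \<in> pverts G \<and> u \<noteq> v \<and> (v, u) \<in> parcs G" for u v
    using G.wellformed'[of u v] G.pair_no_loops[of "(u, v)"] G.pair_sym_arcs
    by (auto simp: symmetric_def dest: symD)
  have H: "(u, v) \<in> parcs H \<Longrightarrow> u \<in> pverts H \<and> v \<in> pverts H \<and> u \<noteq> v \<and> (v, u) \<in> parcs H" for u v
    using H.wellformed'[of u v] H.pair_no_loops[of "(u, v)"] H.pair_sym_arcs
    by (auto simp: symmetric_def dest: symD)
  show ?thesis
    by unfold_locales (auto simp: corona_def symmetric_def dest: G H intro!: symI)
qed

end

theory Submission
  imports Defs
begin

text \<open>
  A proper non-empty subset of a three-element set has one or two elements, so it is a singleton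
  \<open>{x}\<close> or the complement \<open>X - {x}\<close> of one (lemma \<open>proper_nonempty_subsets_card_3\<close>).  Distinct
  singletons are disjoint, so the singletons form \<open>K\<^sub>3\<close>.  Two complements of points always share
  a point, because two points do not exhaust \<open>X\<close>, and \<open>X - {x}\<close> is disjoint from \<open>{y}\<close> exactly when
  \<open>x = y\<close>.  Hence each \<open>X - {x}\<close> is a pendant vertex attached to \<open>{x}\<close>, which is the corona
  \<open>K\<^sub>3 \<odot> K\<^sub>1\<close>.  The isomorphism is written from the corona to the graph of subsets, where it is
  given by a formula on each kind of vertex.
\<close>

text \<open>
  An isomorphism of \<open>Graph_Theory\<close> carries separate maps on vertices and on arcs and requires the
  target to be literally the image.  For graphs whose arcs are pairs of vertices the arc map is
  forced, so a bijection that preserves and reflects adjacency suffices.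
\<close>
lemma digraph_iso_with_projI:
  assumes G: "wf_digraph (with_proj G)" and H: "wf_digraph (with_proj H)"
    and bij: "bij_betw f (pverts G) (pverts H)"
    and adj: "\<And>u v. u \<in> pverts G \<Longrightarrow> v \<in> pverts G \<Longrightarrow>
      (f u, f v) \<in> parcs H \<longleftrightarrow> (u, v) \<in> parcs G"
  shows "digraph_iso (with_proj G) (with_proj H)"
proof -
  define h where "h = \<lparr>iso_verts = f, iso_arcs = map_prod f f, iso_head = snd, iso_tail = fst\<rparr>"
  have sub: "parcs G \<subseteq> pverts G \<times> pverts G"
    using wf_digraph.tail_in_verts[OF G] wf_digraph.head_in_verts[OF G] by force
  have inj: "inj_on f (pverts G)"
    using bij by (rule bij_betw_imp_inj_on)
  have "inj_on (map_prod f f) (parcs G)"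
    using map_prod_inj_on[OF inj inj] sub by (rule inj_on_subset)
  then have iso: "pre_digraph.digraph_isomorphism (with_proj G) h"
    unfolding pre_digraph.digraph_isomorphism_def h_def using G inj by simp
  have "parcs H = map_prod f f ` parcs G"
  proof
    show "map_prod f f ` parcs G \<subseteq> parcs H"
      using sub adj by auto
    show "parcs H \<subseteq> map_prod f f ` parcs G"
    proof
      fix e assume e: "e \<in> parcs H"
      then have "fst e \<in> f ` pverts G" "snd e \<in> f ` pverts G"
        using wf_digraph.tail_in_verts[OF H] wf_digraph.head_in_verts[OF H]
          bij_betw_imp_surj_on[OF bij] by auto
      then obtain u v where "u \<in> pverts G" "v \<in> pverts G" "e = (f u, f v)"
        by (metis imageE prod.collapse)
      then show "e \<in> map_prod f f ` parcs G"
        using adj e by force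
    qed
  qed
  then have "with_proj H = app_iso h (with_proj G)"
    by (simp add: app_iso_def h_def with_proj_def bij_betw_imp_surj_on[OF bij])
  with iso show ?thesis
    unfolding digraph_iso_def by blast
qed

text \<open>
  The sizes of a subset and of its complement are both positive and add up to \<open>3\<close>, so one of them
  is \<open>1\<close>.
\<close>
lemma proper_nonempty_subsets_card_3:
  assumes "card X = 3"
  shows "{A. A \<subseteq> X \<and> A \<noteq> {} \<and> A \<noteq> X} = (\<lambda>x. {x}) ` X \<union> (\<lambda>x. X - {x}) ` X"
proof (rule set_eqI)
  fix A
  have fin: "finite X"
    using assms by (simp add: card_ge_0_finite)
  have "A \<in> (\<lambda>x. {x}) ` X \<union> (\<lambda>x. X - {x}) ` X" if "A \<subseteq> X" "A \<noteq> {}" "A \<noteq> X"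
  proof -
    have "card A + card (X - A) = 3"
      using that fin assms card_mono[OF fin \<open>A \<subseteq> X\<close>]
      by (simp add: card_Diff_subset finite_subset[OF _ fin])
    moreover have "card A \<noteq> 0" "card (X - A) \<noteq> 0"
      using that fin by (auto simp: finite_subset)
    ultimately consider "card A = 1" | "card (X - A) = 1"
      by linarith
    then show ?thesis
    proof cases
      case 1
      then show ?thesis
        using \<open>A \<subseteq> X\<close> by (auto simp: card_1_singleton_iff)
    next
      case 2
      then obtain x where "X - A = {x}"
        by (rule card_1_singletonE)
      then have "x \<in> X" "A = X - {x}"
        using \<open>A \<subseteq> X\<close> by auto
      then show ?thesis by blast
    qed
  qed
  moreover have "{x} \<noteq> X" "X - {x} \<noteq> {}" for x
  proof -
    have "\<not> X \<subseteq> {x}"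
      using assms card_mono[of "{x}" X] by auto
    then show "{x} \<noteq> X" "X - {x} \<noteq> {}" by auto
  qed
  ultimately show "A \<in> {A. A \<subseteq> X \<and> A \<noteq> {} \<and> A \<noteq> X} \<longleftrightarrow>
      A \<in> (\<lambda>x. {x}) ` X \<union> (\<lambda>x. X - {x}) ` X"
    by blast
qed

text \<open>
  Two points do not exhaust \<open>X\<close>.  In a two-element set the complements of the two points are
  disjoint, so the bound cannot be lowered.
\<close>
lemma point_complements_not_disjoint:
  assumes "card X \<ge> 3"
  shows "(X - {x}) \<inter> (X - {y}) \<noteq> {}"
proof
  assume "(X - {x}) \<inter> (X - {y}) = {}"
  then have "X \<subseteq> {x, y}" by blast
  then have "card X \<le> card {x, y}" by (rule card_mono[rotated]) simp
  also have "\<dots> \<le> 2" by (simp add: card_insert_if)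
  finally show False using assms by simp
qed

theorem proposition2p2:
  fixes X :: "'a set"
  assumes "card X = 3"
  shows "digraph_iso (with_proj (discrete_topological_graph (discrete_topology X)))
           (with_proj (corona (complete_pair_graph 3) (complete_pair_graph 1)))"
proof -
  let ?D = "discrete_topological_graph (discrete_topology X)"
  let ?C = "corona (complete_pair_graph 3) (complete_pair_graph 1)"
  have "finite X" using assms by (simp add: card_ge_0_finite)
  then obtain x where x: "bij_betw x {..<3::nat} X"
    using ex_bij_betw_nat_finite[of X] assms by (auto simp: atLeast0LessThan)
  have eq_iff: "x i = x j \<longleftrightarrow> i = j" if "i < 3" "j < 3" for i j
    using x that by (auto simp: bij_betw_def inj_on_def)
  have mem: "x i \<in> X" if "i < 3" for i
    using x that by (auto simp: bij_betw_def)
  have meet: "(X - {x i}) \<inter> (X - {x j}) \<noteq> {}" for i j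
    using assms by (intro point_complements_not_disjoint) simp
  define g :: "nat + nat \<times> nat \<Rightarrow> 'a set"
    where "g = case_sum (\<lambda>i. {x i}) (\<lambda>(i, _). X - {x i})"
  have vD: "pverts ?D = {A. A \<subseteq> X \<and> A \<noteq> {} \<and> A \<noteq> X}"
    by (simp add: discrete_topological_graph_def Let_def)
  have aD: "(A, B) \<in> parcs ?D \<longleftrightarrow> A \<in> pverts ?D \<and> B \<in> pverts ?D \<and> A \<inter> B = {}" for A B
    by (simp add: discrete_topological_graph_def Let_def)
  have vC: "pverts ?C = Inl ` {..<3} \<union> (\<lambda>i. Inr (i, 0)) ` {..<3}"
    by (auto simp: corona_def complete_pair_graph_def)
  have points: "h ` X = (\<lambda>i. h (x i)) ` {..<3}" for h :: "'a \<Rightarrow> 'a set"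
    using bij_betw_imp_surj_on[OF x] by (metis image_image)
  have img: "g ` pverts ?C = pverts ?D"
    unfolding vD vC proper_nonempty_subsets_card_3[OF assms]
      points[of "\<lambda>x. {x}"] points[of "\<lambda>x. X - {x}"]
    by (simp only: g_def image_Un image_image sum.case prod.case)
  have cc_eq: "X - {x i} = X - {x j} \<longleftrightarrow> i = j" if "i < 3" "j < 3" for i j
    using eq_iff[OF that] mem that by blast
  \<comment> \<open>A singleton is not the complement of a point: \<open>{x i}\<close> and \<open>X - {x i}\<close> are disjoint,
    whereas any two complements of points meet.\<close>
  have single_ne: "{x i} \<noteq> X - {x j}" for i j
    using meet[of i j] by blast
  have inj: "inj_on g (pverts ?C)"
    unfolding vC
  proof (rule inj_onI)
    fix u v
    assume "u \<in> Inl ` {..<3} \<union> (\<lambda>i. Inr (i, 0)) ` {..<3}"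
      "v \<in> Inl ` {..<3} \<union> (\<lambda>i. Inr (i, 0)) ` {..<3}" "g u = g v"
    then show "u = v"
      by (elim UnE imageE)
        (simp_all add: g_def eq_iff cc_eq single_ne single_ne[symmetric])
  qed
  have wfC: "wf_digraph (with_proj ?C)"
    by unfold_locales (auto simp: corona_def complete_pair_graph_def)
  have wfD: "wf_digraph (with_proj ?D)"
    by unfold_locales (auto simp: aD)
  have "digraph_iso (with_proj ?C) (with_proj ?D)"
  proof (rule digraph_iso_with_projI)
    show "bij_betw g (pverts ?C) (pverts ?D)"
      using inj img by (simp add: bij_betw_def)
    fix u v assume uv: "u \<in> pverts ?C" "v \<in> pverts ?C"
    then have "(g u, g v) \<in> parcs ?D \<longleftrightarrow> g u \<inter> g v = {}"
      using img by (auto simp: aD)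
    also have "\<dots> \<longleftrightarrow> (u, v) \<in> parcs ?C"
      using uv unfolding vC
      by (elim UnE imageE)
        (auto simp: g_def corona_def complete_pair_graph_def eq_iff mem meet)
    finally show "(g u, g v) \<in> parcs ?D \<longleftrightarrow> (u, v) \<in> parcs ?C" .
  qed (fact wfC wfD)+
  with wfC show ?thesis
    by (rule digraph_iso_swap)
qed

end
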